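(* Let $X$ be an algebraic variety over $\mathbb F_q$, let $C=(\mathcal C,|\cdot|,W)$ be coloring data with weights in $R=\mathbb Z[[t_1,\dots,t_N]][t_1^{-1},\dots,t_N^{-1}]$, and for $d\ge 1$ let $\tilde N_d=\tilde N_d(X)$ be the number of $\mathrm{Frob}_q$-orbits of size $d$ in $X(\overline{\mathbb F}_q)$. Then the following identity holds in $R[[T]]$: $$Z_C(X,t,T)=\prod_{d\ge 1} Z_C(\bullet,t^d,T^d)^{\tilde N_d},$$ where $Z_C(\bullet,t^d,T^d)$ is obtained from $Z_C(\bullet,t,T)$ by substituting $t_i\mapsto t_i^d$ for all $i$ and $T\mapsto T^d$.
   Context: $\mathbb F_q$ is a finite field with $q$ elements, $\overline{\mathbb F}_q$ a fixed algebraic closure, and $\mathrm{Frob}_q: x\mapsto x^q$ the Frobenius automorphism, acting on $X(\overline{\mathbb F}_q)$. Coloring data $C=(\mathcal C,|\cdot|,W)$ consists of: a set $\mathcal C$ of colors; a degree function $|\cdot|:\mathcal C\to\mathbb Z_{\ge 0}$ such that there are finitely many colors of each degree and there is a unique color $0\in\mathcal C$ of degree $0$; and a weight function $W:\mathcal C\to R$ with $W(0)=1$, where $R=\mathbb Z[[t_1,\dots,t_N]][t_1^{-1},\dots,t_N^{-1}]$. For $f\in R$ and an integer $d\ge1$, $f(t^d)$ denotes the result of substituting $t_i\mapsto t_i^d$ for all $i$. A coloring on $X$ is a map $\Lambda:X(\overline{\mathbb F}_q)\to\mathcal C$ with $\Lambda(x)=0$ for all but finitely many $x$; its degree is $|\Lambda|=\sum_{x\in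 X(\overline{\mathbb F}_q)}|\Lambda(x)|$. It is a coloring of $X/\mathbb F_q$ if $\Lambda(\mathrm{Frob}_q(x))=\Lambda(x)$ for all $x$. The weight of a coloring $\Lambda$ of $X/\mathbb F_q$ is $W(\Lambda)=\prod_{\{x\}}W(\Lambda(x))(t^{d(x)})$, the product running over the $\mathrm{Frob}_q$-orbits $\{x\}$ in $X(\overline{\mathbb F}_q)$, with $d(x)$ the size of the orbit of $x$. The coloring zeta function of $X$ is $Z_C(X,t,T)=\sum_\Lambda W(\Lambda)T^{|\Lambda|}\in R[[T]]$, the sum running over all colorings $\Lambda$ of $X/\mathbb F_q$. For $X=\bullet$ a point this is $Z_C(\bullet,t,T)=\sum_{\lambda\in\mathcal C}W(\lambda)T^{|\lambda|}$. *)

theory Defs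
  imports "HOL-Analysis.Analysis" "HOL-Algebra.Algebraic_Closure_Type" "HOL-Library.Poly_Mapping"
begin

(* here $ selects components of vectors *)
no_notation fps_nth (infixl \<open>$\<close> 75)

section \<open>The ring of integral Laurent series in finitely many variables\<close>

text \<open>
  The variables $t_i$ are indexed by a finite type \<open>'n\<close>. An element of
  $\mathbf{Z}[[t_1,\ldots,t_N]][t_1^{-1},\ldots,t_N^{-1}]$ is a power series divided by a monomial,
  i.e. a family of integer coefficients, indexed by the exponent vectors, whose support is bounded
  below in the componentwise order on \<^typ>\<open>int ^ 'n\<close>.
\<close>

typedef (overloaded) ('n :: finite) mlaurent =
  "{f :: int ^ 'n \<Rightarrow> int. \<exists>l. \<forall>e. f e \<noteq> 0 \<longrightarrow> l \<le> e}"
  morphisms mcoeff Abs_mlaurent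
  by (rule exI[of _ "\<lambda>_. 0"]) auto

setup_lifting type_definition_mlaurent

lemma mlaurent_eqI: "(\<And>e. mcoeff f e = mcoeff g e) \<Longrightarrow> f = g"
  by transfer auto

lemma mlaurent_bound: obtains l where "\<And>e. mcoeff f e \<noteq> 0 \<Longrightarrow> l \<le> e"
  using mcoeff[of f] by auto

lemma vec_leI: "(\<And>i. l $ i \<le> e $ i) \<Longrightarrow> l \<le> e" for l e :: "int ^ 'n"
  by (simp add: less_eq_vec_def)

lemma vec_leD: "l \<le> e \<Longrightarrow> l $ i \<le> e $ i" for l e :: "int ^ 'n"
  by (simp add: less_eq_vec_def)

lemma finite_vec_Icc: "finite {l..u :: int ^ 'n :: finite}"
proof (rule finite_subset)
  show "{l..u} \<subseteq> vec_lambda ` (\<Pi>\<^sub>E i\<in>UNIV. {l $ i..u $ i})"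
    by (auto simp: less_eq_vec_def image_iff intro!: bexI[of _ "vec_nth _"] PiE_I)
qed (intro finite_imageI finite_PiE, auto)

lemma mlaurent_conv_subset:
  fixes f g :: "int ^ 'n :: finite \<Rightarrow> int"
  assumes "\<And>e. f e \<noteq> 0 \<Longrightarrow> l \<le> e" "\<And>e. g e \<noteq> 0 \<Longrightarrow> l' \<le> e"
  shows "{a. f a * g (e - a) \<noteq> 0} \<subseteq> {l..e - l'}"
proof
  fix a assume "a \<in> {a. f a * g (e - a) \<noteq> 0}"
  hence "l \<le> a" "l' \<le> e - a" using assms by auto
  moreover from this(2) have "a \<le> e - l'" by (simp add: less_eq_vec_def algebra_simps)
  ultimately show "a \<in> {l..e - l'}" by simp
qed

instantiation mlaurent :: (finite) comm_ring_1
begin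

lift_definition zero_mlaurent :: "'a mlaurent" is "\<lambda>_. 0" by auto

lift_definition one_mlaurent :: "'a mlaurent" is "\<lambda>e. if e = 0 then 1 else 0"
  by (auto intro!: exI[of _ 0])

lift_definition plus_mlaurent :: "'a mlaurent \<Rightarrow> 'a mlaurent \<Rightarrow> 'a mlaurent"
  is "\<lambda>f g e. f e + g e"
proof -
  fix f g :: "int ^ 'a \<Rightarrow> int"
  assume "\<exists>l. \<forall>e. f e \<noteq> 0 \<longrightarrow> l \<le> e" "\<exists>l. \<forall>e. g e \<noteq> 0 \<longrightarrow> l \<le> e"
  then obtain l l' where l: "\<And>e. f e \<noteq> 0 \<Longrightarrow> l \<le> e" "\<And>e. g e \<noteq> 0 \<Longrightarrow> l' \<le> e" by blast
  have "(\<chi> i. min (l $ i) (l' $ i)) \<le> e" if "f e + g e \<noteq> 0" for e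
  proof -
    have "f e \<noteq> 0 \<or> g e \<noteq> 0" using that by auto
    thus ?thesis using l[of e] by (auto simp: less_eq_vec_def min_le_iff_disj)
  qed
  thus "\<exists>l. \<forall>e. f e + g e \<noteq> 0 \<longrightarrow> l \<le> e" by blast
qed

lift_definition uminus_mlaurent :: "'a mlaurent \<Rightarrow> 'a mlaurent" is "\<lambda>f e. - f e" by auto

definition minus_mlaurent :: "'a mlaurent \<Rightarrow> 'a mlaurent \<Rightarrow> 'a mlaurent"
  where "minus_mlaurent f g = f + (- g)"

text \<open>The sum ranges over a finite set by \<open>mlaurent_conv_subset\<close>.\<close>

lift_definition times_mlaurent :: "'a mlaurent \<Rightarrow> 'a mlaurent \<Rightarrow> 'a mlaurent"
  is "\<lambda>f g e. \<Sum>a | f a * g (e - a) \<noteq> 0. f a * g (e - a)"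
proof -
  fix f g :: "int ^ 'a \<Rightarrow> int"
  assume "\<exists>l. \<forall>e. f e \<noteq> 0 \<longrightarrow> l \<le> e" "\<exists>l. \<forall>e. g e \<noteq> 0 \<longrightarrow> l \<le> e"
  then obtain l l' where l: "\<And>e. f e \<noteq> 0 \<Longrightarrow> l \<le> e" "\<And>e. g e \<noteq> 0 \<Longrightarrow> l' \<le> e" by blast
  have "l + l' \<le> e" if nz: "(\<Sum>a | f a * g (e - a) \<noteq> 0. f a * g (e - a)) \<noteq> 0" for e
  proof -
    obtain a where "f a * g (e - a) \<noteq> 0"
      by (rule sum.not_neutral_contains_not_neutral[OF nz]) blast
    hence *: "l \<le> a" "l' \<le> e - a" using l by auto
    show ?thesis
    proof (rule vec_leI)
      fix i show "(l + l') $ i \<le> e $ i" using vec_leD[OF *(1), of i] vec_leD[OF *(2), of i] by simp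
    qed
  qed
  thus "\<exists>l. \<forall>e. (\<Sum>a | f a * g (e - a) \<noteq> 0. f a * g (e - a)) \<noteq> 0 \<longrightarrow> l \<le> e" by blast
qed

lemma mcoeff_times:
  fixes f g :: "'a mlaurent"
  assumes "finite S" "\<And>a. mcoeff f a * mcoeff g (e - a) \<noteq> 0 \<Longrightarrow> a \<in> S"
  shows "mcoeff (f * g) e = (\<Sum>a\<in>S. mcoeff f a * mcoeff g (e - a))"
  unfolding times_mlaurent.rep_eq
  by (rule sum.mono_neutral_left) (use assms in auto)

instance
proof
  fix a b c :: "'a mlaurent"
  obtain la where la: "\<And>e. mcoeff a e \<noteq> 0 \<Longrightarrow> la \<le> e" using mlaurent_bound by blast
  obtain lb where lb: "\<And>e. mcoeff b e \<noteq> 0 \<Longrightarrow> lb \<le> e" using mlaurent_bound by blast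
  obtain lc where lc: "\<And>e. mcoeff c e \<noteq> 0 \<Longrightarrow> lc \<le> e" using mlaurent_bound by blast
  have lab: "la + lb \<le> e" if nz: "mcoeff (a * b) e \<noteq> 0" for e
  proof -
    obtain x where "mcoeff a x * mcoeff b (e - x) \<noteq> 0"
      by (rule sum.not_neutral_contains_not_neutral[OF nz[unfolded times_mlaurent.rep_eq]]) blast
    hence *: "la \<le> x" "lb \<le> e - x" using la lb by auto
    show ?thesis
    proof (rule vec_leI)
      fix i show "(la + lb) $ i \<le> e $ i" using vec_leD[OF *(1), of i] vec_leD[OF *(2), of i] by simp
    qed
  qed
  show "a + b + c = a + (b + c)" by transfer (auto simp: add.assoc)
  show "a + b = b + a" by transfer (auto simp: add.commute)
  show "0 + a = a" by transfer auto
  show "- a + a = 0" by transfer auto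
  show "a - b = a + - b" by (simp add: minus_mlaurent_def)
  show "(0 :: 'a mlaurent) \<noteq> 1" by transfer (auto dest: fun_cong[of _ _ 0])
  show "1 * a = a"
  proof (rule mlaurent_eqI)
    fix e show "mcoeff (1 * a) e = mcoeff a e"
      by (subst mcoeff_times[of "{0}"]) (auto simp: one_mlaurent.rep_eq split: if_splits)
  qed
  show "a * b = b * a"
  proof (rule mlaurent_eqI)
    fix e
    show "mcoeff (a * b) e = mcoeff (b * a) e"
      unfolding times_mlaurent.rep_eq
      by (rule sum.reindex_bij_witness[of _ "\<lambda>x. e - x" "\<lambda>x. e - x"]) auto
  qed
  show "(a + b) * c = a * c + b * c"
  proof (rule mlaurent_eqI)
    fix e
    let ?S = "{la..e - lc} \<union> {lb..e - lc}"
    have fin: "finite ?S" by (simp add: finite_vec_Icc)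
    have *: "x \<in> {la..e - lc}" if "mcoeff a x * mcoeff c (e - x) \<noteq> 0" for x
      using mlaurent_conv_subset[of "mcoeff a" la "mcoeff c" lc e] la lc that by blast
    have **: "x \<in> {lb..e - lc}" if "mcoeff b x * mcoeff c (e - x) \<noteq> 0" for x
      using mlaurent_conv_subset[of "mcoeff b" lb "mcoeff c" lc e] lb lc that by blast
    have "mcoeff ((a + b) * c) e = (\<Sum>x\<in>?S. mcoeff (a + b) x * mcoeff c (e - x))"
    proof (rule mcoeff_times[OF fin])
      fix x assume "mcoeff (a + b) x * mcoeff c (e - x) \<noteq> 0"
      hence "mcoeff a x * mcoeff c (e - x) \<noteq> 0 \<or> mcoeff b x * mcoeff c (e - x) \<noteq> 0"
        by (auto simp: plus_mlaurent.rep_eq)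
      thus "x \<in> ?S" using * ** by blast
    qed
    also have "\<dots> = (\<Sum>x\<in>?S. mcoeff a x * mcoeff c (e - x)) + (\<Sum>x\<in>?S. mcoeff b x * mcoeff c (e - x))"
      by (simp add: plus_mlaurent.rep_eq sum.distrib algebra_simps)
    also have "(\<Sum>x\<in>?S. mcoeff a x * mcoeff c (e - x)) = mcoeff (a * c) e"
      by (rule mcoeff_times[symmetric, OF fin]) (use * in blast)
    also have "(\<Sum>x\<in>?S. mcoeff b x * mcoeff c (e - x)) = mcoeff (b * c) e"
      by (rule mcoeff_times[symmetric, OF fin]) (use ** in blast)
    finally show "mcoeff ((a + b) * c) e = mcoeff (a * c + b * c) e"
      by (simp add: plus_mlaurent.rep_eq)
  qed
  show "a * b * c = a * (b * c)"
  proof (rule mlaurent_eqI)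
    fix e
    let ?T = "{la + lb..e - lc}" and ?S = "{la..e - lc - lb}"
    have "mcoeff (a * b * c) e = (\<Sum>y\<in>?T. mcoeff (a * b) y * mcoeff c (e - y))"
      using mlaurent_conv_subset[of "mcoeff (a * b)" "la + lb" "mcoeff c" lc e] lab lc
      by (intro mcoeff_times finite_vec_Icc) blast
    also have "\<dots> = (\<Sum>y\<in>?T. (\<Sum>x\<in>?S. mcoeff a x * mcoeff b (y - x)) * mcoeff c (e - y))"
    proof (intro sum.cong refl arg_cong2[of _ _ _ _ "(*)"] mcoeff_times finite_vec_Icc)
      fix x y assume y: "y \<in> ?T" and nz: "mcoeff a x * mcoeff b (y - x) \<noteq> 0"
      hence *: "la \<le> x" "lb \<le> y - x" using la lb by auto
      have "x $ i \<le> (e - lc - lb) $ i" for i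
        using vec_leD[OF *(2), of i] vec_leD[of y "e - lc" i] y by simp
      with *(1) show "x \<in> ?S" by (simp add: vec_leI)
    qed
    also have "\<dots> = (\<Sum>x\<in>?S. \<Sum>y\<in>?T. mcoeff a x * (mcoeff b (y - x) * mcoeff c (e - y)))"
      by (subst sum.swap) (simp add: sum_distrib_right mult.assoc)
    also have "\<dots> = (\<Sum>x\<in>?S. mcoeff a x * mcoeff (b * c) (e - x))"
    proof (intro sum.cong refl)
      fix x
      show "(\<Sum>y\<in>?T. mcoeff a x * (mcoeff b (y - x) * mcoeff c (e - y)))
              = mcoeff a x * mcoeff (b * c) (e - x)"
      proof (cases "mcoeff a x = 0")
        case False
        hence lx: "la \<le> x" using la by auto
        let ?T' = "(\<lambda>y. y - x) ` ?T"
        have "mcoeff (b * c) (e - x) = (\<Sum>z\<in>?T'. mcoeff b z * mcoeff c (e - x - z))"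
        proof (intro mcoeff_times finite_imageI finite_vec_Icc)
          fix z assume "mcoeff b z * mcoeff c (e - x - z) \<noteq> 0"
          hence *: "lb \<le> z" "lc \<le> e - x - z" using lb lc by auto
          have "(la + lb) $ i \<le> (z + x) $ i" for i
            using vec_leD[OF *(1), of i] vec_leD[OF lx, of i] by simp
          moreover have "(z + x) $ i \<le> (e - lc) $ i" for i
            using vec_leD[OF *(2), of i] by simp
          ultimately have "z + x \<in> ?T" by (simp add: vec_leI del: vector_add_component vector_minus_component)
          thus "z \<in> ?T'" by (intro image_eqI[of _ _ "z + x"]) auto
        qed
        also have "\<dots> = (\<Sum>y\<in>?T. mcoeff b (y - x) * mcoeff c (e - y))"
          by (subst sum.reindex) (auto simp: inj_on_def)
        finally show ?thesis by (simp add: sum_distrib_left)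
      qed simp
    qed
    also have "\<dots> = mcoeff (a * (b * c)) e"
    proof (intro mcoeff_times[symmetric] finite_vec_Icc)
      fix x assume nz: "mcoeff a x * mcoeff (b * c) (e - x) \<noteq> 0"
      hence "mcoeff (b * c) (e - x) \<noteq> 0" by auto
      then obtain z where "mcoeff b z * mcoeff c (e - x - z) \<noteq> 0"
        unfolding times_mlaurent.rep_eq
        by (rule sum.not_neutral_contains_not_neutral) blast
      hence *: "la \<le> x" "lb \<le> z" "lc \<le> e - x - z" using nz la lb lc by auto
      have "x $ i \<le> (e - lc - lb) $ i" for i
        using vec_leD[OF *(2), of i] vec_leD[OF *(3), of i] by simp
      with *(1) show "x \<in> ?S" by (simp add: vec_leI)
    qed
    finally show "mcoeff (a * b * c) e = mcoeff (a * (b * c)) e" .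
  qed
qed

end

text \<open>
  The substitutions $t_i \mapsto t_i^d$ for all \<open>i\<close>, resp. additionally $T \mapsto T^d$, are
  meaningful for \<open>d \<ge> 1\<close> only.
\<close>

lift_definition msubst :: "nat \<Rightarrow> ('n :: finite) mlaurent \<Rightarrow> 'n mlaurent"
  is "\<lambda>d f e. if \<forall>i. int d dvd e $ i then f (\<chi> i. e $ i div int d) else 0"
proof -
  fix d :: nat and f :: "int ^ 'n \<Rightarrow> int"
  assume "\<exists>l. \<forall>e. f e \<noteq> 0 \<longrightarrow> l \<le> e"
  then obtain l where l: "\<And>e. f e \<noteq> 0 \<Longrightarrow> l \<le> e" by blast
  have "(\<chi> i. int d * l $ i) \<le> e"
    if "\<forall>i. int d dvd e $ i" "f (\<chi> i. e $ i div int d) \<noteq> 0" for e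
  proof -
    have "l $ i \<le> e $ i div int d" for i using l[OF that(2)] by (auto simp: less_eq_vec_def)
    hence "int d * l $ i \<le> int d * (e $ i div int d)" for i by (intro mult_left_mono) auto
    thus ?thesis using that(1) by (auto simp: less_eq_vec_def)
  qed
  thus "\<exists>l. \<forall>e. (if \<forall>i. int d dvd e $ i then f (\<chi> i. e $ i div int d) else 0) \<noteq> 0 \<longrightarrow> l \<le> e"
    by (intro exI[of _ "\<chi> i. int d * l $ i"]) auto
qed

definition subst_tT :: "nat \<Rightarrow> ('n :: finite) mlaurent fps \<Rightarrow> 'n mlaurent fps"
  where "subst_tT d Z = fps_compose (Abs_fps (\<lambda>n. msubst d (fps_nth Z n))) (fps_X ^ d)"


section \<open>Varieties over a finite field\<close>

text \<open>
  The finite field is a type \<open>'q\<close> of sort \<open>{field, finite}\<close>, and its algebraic closure is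
  \<^typ>\<open>'q alg_closure\<close>. Polynomials have coefficients in \<open>'q\<close>, points have coordinates in the
  closure; a point of affine \<open>n\<close>-space is a list of length \<open>n\<close>. Topological notions refer to the
  Zariski topology defined over \<open>'q\<close>, whose closed sets are the zero loci of polynomials with
  coefficients in \<open>'q\<close>.
\<close>

type_synonym 'a mpoly = "(nat \<Rightarrow>\<^sub>0 nat) \<Rightarrow>\<^sub>0 'a"

definition mpolys :: "nat \<Rightarrow> ('a :: zero) mpoly set"
  where "mpolys n = {p. \<forall>m \<in> Poly_Mapping.keys p. Poly_Mapping.keys m \<subseteq> {..<n}}"

definition mpoly_eval :: "('q :: field) mpoly \<Rightarrow> 'q alg_closure list \<Rightarrow> 'q alg_closure"
  where "mpoly_eval p x = (\<Sum>m \<in> Poly_Mapping.keys p.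
           to_ac (Poly_Mapping.lookup p m) *
             (\<Prod>i \<in> Poly_Mapping.keys m. (x ! i) ^ Poly_Mapping.lookup m i))"

definition zclosed :: "nat \<Rightarrow> ('q :: field) alg_closure list set \<Rightarrow> bool"
  where "zclosed n V \<longleftrightarrow>
           (\<exists>P \<subseteq> mpolys n. V = {x. length x = n \<and> (\<forall>p\<in>P. mpoly_eval p x = 0)})"

definition zopen_in :: "nat \<Rightarrow> ('q :: field) alg_closure list set \<Rightarrow> 'q alg_closure list set \<Rightarrow> bool"
  where "zopen_in n V U \<longleftrightarrow> (\<exists>Z. zclosed n Z \<and> U = V - Z)"

definition regular_on ::
  "nat \<Rightarrow> ('q :: field) alg_closure list set \<Rightarrow> ('q alg_closure list \<Rightarrow> 'q alg_closure) \<Rightarrow> bool"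
  where "regular_on n U f \<longleftrightarrow>
           (\<forall>x\<in>U. \<exists>A. zopen_in n U A \<and> x \<in> A \<and>
             (\<exists>g \<in> mpolys n. \<exists>h \<in> mpolys n. \<forall>y\<in>A.
                mpoly_eval h y \<noteq> 0 \<and> f y = mpoly_eval g y / mpoly_eval h y))"

text \<open>
  A variety over \<open>'q\<close> is given by its set of points over the algebraic closure together with a
  finite atlas of affine charts: the \<open>i\<close>-th chart identifies \<open>dom V i\<close> with a closed subset of affine
  \<open>adim V i\<close>-space defined over \<open>'q\<close>, and the gluing maps are isomorphisms, defined over \<open>'q\<close>,
  between open subsets defined over \<open>'q\<close>. The last condition below is separatedness:
  the diagonal is closed. Varieties need not be irreducible, affine or projective.
\<close>

record ('p, 'k) atlas =
  points :: "'p set"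
  ncharts :: nat
  adim :: "nat \<Rightarrow> nat"
  dom :: "nat \<Rightarrow> 'p set"
  chart :: "nat \<Rightarrow> 'p \<Rightarrow> 'k list"

definition variety :: "('p, ('q :: {field, finite}) alg_closure) atlas \<Rightarrow> bool"
  where "variety V \<longleftrightarrow>
    points V = (\<Union>i<ncharts V. dom V i) \<and>
    (\<forall>i<ncharts V. inj_on (chart V i) (dom V i) \<and> zclosed (adim V i) (chart V i ` dom V i)) \<and>
    (\<forall>i<ncharts V. \<forall>j<ncharts V.
       zopen_in (adim V i) (chart V i ` dom V i) (chart V i ` (dom V i \<inter> dom V j)) \<and>
       (\<forall>k<adim V j. regular_on (adim V i) (chart V i ` (dom V i \<inter> dom V j))
          (\<lambda>y. chart V j (inv_into (dom V i) (chart V i) y) ! k)) \<and>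
       zclosed (adim V i + adim V j) ((\<lambda>x. chart V i x @ chart V j x) ` (dom V i \<inter> dom V j)))"

text \<open>
  The Frobenius map raises the coordinates in any chart around the point to the \<open>q\<close>-th power;
  this does not depend on the chart, as the gluing maps are defined over \<open>'q\<close>.
\<close>

definition frob :: "('p, ('q :: {field, finite}) alg_closure) atlas \<Rightarrow> 'p \<Rightarrow> 'p"
  where "frob V x = (THE y. \<exists>i<ncharts V. x \<in> dom V i \<and> y \<in> dom V i \<and>
           chart V i y = map (\<lambda>a. a ^ CARD('q)) (chart V i x))"

definition frob_orbits :: "('p, ('q :: {field, finite}) alg_closure) atlas \<Rightarrow> 'p set set"
  where "frob_orbits V = (\<lambda>x. range (\<lambda>k. (frob V ^^ k) x)) ` points V"

definition num_orbits :: "('p, ('q :: {field, finite}) alg_closure) atlas \<Rightarrow> nat \<Rightarrow> nat"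
  where "num_orbits V d = card {B \<in> frob_orbits V. card B = d}"

definition point_variety :: "(unit, ('q :: {field, finite}) alg_closure) atlas"
  where "point_variety = \<lparr>points = UNIV, ncharts = 1, adim = (\<lambda>_. 0), dom = (\<lambda>_. UNIV),
           chart = (\<lambda>_ _. [])\<rparr>"


section \<open>Colorings and the coloring zeta function\<close>

text \<open>The set of colors is the type \<open>'c\<close>.\<close>

record ('c, 'r) coloring_data =
  cdeg :: "'c \<Rightarrow> nat"
  cweight :: "'c \<Rightarrow> 'r"

definition zero_color :: "('c, 'r) coloring_data \<Rightarrow> 'c"
  where "zero_color C = (THE c. cdeg C c = 0)"

definition coloring_data :: "('c, ('n :: finite) mlaurent) coloring_data \<Rightarrow> bool"
  where "coloring_data C \<longleftrightarrow>
    (\<forall>n. finite {c. cdeg C c = n}) \<and> (\<exists>!c. cdeg C c = 0) \<and> cweight C (zero_color C) = 1"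

definition colored_points :: "('c, 'r) coloring_data \<Rightarrow> ('p, 'k) atlas \<Rightarrow> ('p \<Rightarrow> 'c) \<Rightarrow> 'p set"
  where "colored_points C V L = {x \<in> points V. L x \<noteq> zero_color C}"

text \<open>
  Maps on the set of points are represented by functions that are \<^const>\<open>undefined\<close> elsewhere.
\<close>

definition colorings ::
  "('c, 'r) coloring_data \<Rightarrow> ('p, ('q :: {field, finite}) alg_closure) atlas \<Rightarrow> ('p \<Rightarrow> 'c) set"
  where "colorings C V = {L \<in> points V \<rightarrow>\<^sub>E UNIV.
           finite (colored_points C V L) \<and> (\<forall>x \<in> points V. L (frob V x) = L x)}"

definition coloring_deg :: "('c, 'r) coloring_data \<Rightarrow> ('p, 'k) atlas \<Rightarrow> ('p \<Rightarrow> 'c) \<Rightarrow> nat"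
  where "coloring_deg C V L = (\<Sum>x \<in> colored_points C V L. cdeg C (L x))"

text \<open>
  This is $\prod_{\{x\}} W(\Lambda(x))(t^{d(x)})$. The product may be restricted to the finitely many orbits in the support of the coloring, as the
  color of degree zero has weight 1; \<^const>\<open>prod\<close> over all orbits would be wrong, as it is 1 for
  infinitely many orbits. On an orbit, \<open>L\<close> takes a single value.
\<close>

definition coloring_weight ::
  "('c, ('n :: finite) mlaurent) coloring_data \<Rightarrow>
   ('p, ('q :: {field, finite}) alg_closure) atlas \<Rightarrow> ('p \<Rightarrow> 'c) \<Rightarrow> 'n mlaurent"
  where "coloring_weight C V L =
    (\<Prod>B | B \<in> frob_orbits V \<and> B \<subseteq> colored_points C V L. msubst (card B) (cweight C (the_elem (L ` B))))"

definition coloring_zeta ::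
  "('c, ('n :: finite) mlaurent) coloring_data \<Rightarrow>
   ('p, ('q :: {field, finite}) alg_closure) atlas \<Rightarrow> 'n mlaurent fps"
  where "coloring_zeta C V =
    Abs_fps (\<lambda>n. \<Sum>L | L \<in> colorings C V \<and> coloring_deg C V L = n. coloring_weight C V L)"

lemma variety_point: "variety (point_variety :: (unit, ('q :: {field, finite}) alg_closure) atlas)"
proof -
  have *: "zclosed 0 {[] :: 'q alg_closure list}"
    unfolding zclosed_def by (rule exI[of _ "{}"]) auto
  have "zclosed 0 ({} :: 'q alg_closure list set)"
  proof -
    have "mpoly_eval (1 :: 'q mpoly) x \<noteq> 0" for x
      by (simp add: mpoly_eval_def)
    moreover have "(1 :: 'q mpoly) \<in> mpolys 0" by (simp add: mpolys_def)
    ultimately show ?thesis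
      unfolding zclosed_def by (intro exI[of _ "{1}"]) auto
  qed
  hence "zopen_in 0 {[]} {[] :: 'q alg_closure list}"
    unfolding zopen_in_def by (intro exI[of _ "{}"]) auto
  with * show ?thesis
    by (auto simp: variety_def point_variety_def inj_on_def)
qed

lemma coloring_zeta_point:
  fixes C :: "('c, ('n :: finite) mlaurent) coloring_data"
  assumes "coloring_data C"
  shows "coloring_zeta C (point_variety :: (unit, ('q :: {field, finite}) alg_closure) atlas) =
           Abs_fps (\<lambda>n. \<Sum>c | cdeg C c = n. cweight C c)"
proof -
  define V where "V = (point_variety :: (unit, 'q alg_closure) atlas)"
  have pts: "points V = UNIV" by (simp add: V_def point_variety_def)
  have zero: "cdeg C c = 0 \<longleftrightarrow> c = zero_color C" for c
  proof -
    have ex1: "\<exists>!c. cdeg C c = 0" using assms by (simp add: coloring_data_def)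
    thus ?thesis using theI'[OF ex1] unfolding zero_color_def by blast
  qed
  have W0: "cweight C (zero_color C) = 1" using assms by (simp add: coloring_data_def)
  have orb: "frob_orbits V = {UNIV}"
    unfolding frob_orbits_def pts by (auto simp: image_iff UNIV_unit)
  have cp: "colored_points C V L = (if L () = zero_color C then {} else UNIV)" for L
    by (auto simp: colored_points_def pts)
  have cols: "colorings C V = UNIV" by (auto simp: colorings_def pts)
  have deg: "coloring_deg C V L = cdeg C (L ())" for L
    using zero by (auto simp: coloring_deg_def cp UNIV_unit)
  have msubst_1: "msubst 1 f = f" for f :: "'n mlaurent"
    by transfer auto
  have wt: "coloring_weight C V L = cweight C (L ())" for L
  proof (cases "L () = zero_color C")
    case True
    have *: "{B. B \<in> frob_orbits V \<and> B \<subseteq> colored_points C V L} = {}"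
      using True by (auto simp: orb cp)
    show ?thesis unfolding coloring_weight_def * using W0 True by simp
  next
    case False
    have *: "{B. B \<in> frob_orbits V \<and> B \<subseteq> colored_points C V L} = {{()}}"
      using False by (auto simp: orb cp UNIV_unit)
    show ?thesis unfolding coloring_weight_def * using msubst_1 by simp
  qed
  have "(\<Sum>L | L \<in> colorings C V \<and> coloring_deg C V L = n. coloring_weight C V L) =
          (\<Sum>c | cdeg C c = n. cweight C c)" for n
    by (rule sum.reindex_bij_witness[of _ "\<lambda>c _. c" "\<lambda>L. L ()"]) (auto simp: cols deg wt)
  thus ?thesis by (simp add: coloring_zeta_def flip: V_def)
qed

end

theory Submission
  imports Defs
begin

text \<open>
  A coloring that is invariant under Frobenius is the same as a choice of one color for each Frobenius
  orbit, where all but finitely many orbits, and all infinite ones, receive the zero color. The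
  degree is then additive and the weight multiplicative over the orbits, and an orbit \<open>B\<close> with color
  $c$ contributes $|B| \cdot |c|$ and $W(c)(t^{|B|})$. So an orbit of size $d$ corresponds to one factor
  $Z_C(\bullet, t^d, T^d)$, and expanding a finite product of such factors
  (\<open>prod_generating_functions\<close>) gives the sum over all colorings supported on the given orbits.

  A colored orbit has at most as many points as the degree of the coloring. The coefficient of $T^n$
  in the zeta function thus involves only the orbits with at most $n$ points, and it agrees with the
  coefficient of $T^n$ in each sufficiently long partial product (\<open>coloring_zeta_nth_eq\<close> and
  \<open>prod_subst_tT_nth\<close>). This is convergence in the \<open>T\<close>-adic topology; the limit is nonzero because
  its constant coefficient is 1.

  The geometric input consists of two facts. First, the Frobenius map is an injective self-map
  of the set of points (\<open>inj_on_frob\<close>), so that its finite forward orbits are cycles and any two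
  of them are equal or disjoint. It is well-defined because $x \mapsto x^q$ is a field endomorphism of
  the algebraic closure that fixes the base field, and so commutes with the gluing maps. Second,
  there are only finitely many orbits of each size (\<open>finite_frob_orbits_of_bounded_card\<close>): the
  coordinates of a point fixed by the $k$-th iterate of Frobenius satisfy $a^{q^k} = a$.
\<close>


section \<open>The Frobenius endomorphism of the algebraic closure\<close>

lemma finite_field_power_card:
  fixes x :: "'q :: {field, finite}"
  shows "x ^ CARD('q) = x"
proof (cases "x = 0")
  case False
  have "(\<Prod>y\<in>UNIV-{0}. x * y) = (\<Prod>y\<in>UNIV-{0::'q}. y)"
    by (rule prod.reindex_bij_witness[of _ "\<lambda>y. y / x" "\<lambda>y. x * y"]) (use False in auto)
  hence "x ^ (CARD('q) - 1) * \<Prod>(UNIV-{0::'q}) = \<Prod>(UNIV-{0})"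
    by (simp add: prod.distrib)
  hence "x ^ (CARD('q) - 1) = 1"
    by simp
  hence "x * x ^ (CARD('q) - 1) = x"
    by simp
  thus ?thesis
    by (simp flip: power_Suc)
qed simp

lemma card_field_ge_2: "CARD('q :: {field, finite}) \<ge> 2"
proof -
  have "card {0, 1 :: 'q} \<le> CARD('q)"
    by (rule card_mono) auto
  thus ?thesis by simp
qed

text \<open>
  The polynomial $(X+1)^q - X^q - 1$ has degree less than $q$ and vanishes at all $q$ elements of
  the field. This makes $x \mapsto x^q$ additive without first showing that $q$ is a power
  of the characteristic.
\<close>

lemma of_nat_card_choose_eq_0:
  assumes "0 < k" "k < CARD('q :: {field, finite})"
  shows "(of_nat (CARD('q) choose k) :: 'q) = 0"
proof -
  let ?q = "CARD('q)"
  define P :: "'q poly" where "P = (\<Sum>i\<in>{0<..<?q}. Polynomial.monom (of_nat (?q choose i)) i)"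
  have coeff: "poly.coeff P k = of_nat (?q choose k)"
    using assms by (simp add: P_def coeff_sum)
  have root: "poly P x = 0" for x
  proof -
    have "x + 1 = (x + 1) ^ ?q"
      by (simp add: finite_field_power_card)
    also have "\<dots> = (\<Sum>i\<le>?q. of_nat (?q choose i) * x ^ i)"
      by (simp add: binomial_ring)
    also have "{..?q} = insert 0 (insert ?q {0<..<?q})"
      by auto
    also have "(\<Sum>i\<in>\<dots>. of_nat (?q choose i) * x ^ i) = 1 + x + poly P x"
      by (simp add: P_def poly_sum Polynomial.poly_monom finite_field_power_card)
    finally show ?thesis by simp
  qed
  have "P = 0"
  proof (rule ccontr)
    assume "P \<noteq> 0"
    have "Polynomial.degree P \<le> ?q - 1"
      unfolding P_def by (intro degree_sum_le order.trans[OF degree_monom_le]) auto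
    moreover have "card {x. poly P x = 0} \<le> Polynomial.degree P"
      by (rule card_poly_roots_bound) fact
    ultimately show False
      using root card_field_ge_2[where 'q = 'q] by simp
  qed
  thus ?thesis using coeff by simp
qed

lemma alg_closure_frobenius_add:
  fixes x y :: "('q :: {field, finite}) alg_closure"
  shows "(x + y) ^ CARD('q) = x ^ CARD('q) + y ^ CARD('q)"
proof -
  let ?q = "CARD('q)"
  have "(x + y) ^ ?q = (\<Sum>i\<le>?q. of_nat (?q choose i) * x ^ i * y ^ (?q - i))"
    by (rule binomial_ring)
  also have "\<dots> = (\<Sum>i\<in>{0, ?q}. of_nat (?q choose i) * x ^ i * y ^ (?q - i))"
  proof (intro sum.mono_neutral_right ballI)
    fix i assume "i \<in> {..?q} - {0, ?q}"
    hence "(of_nat (?q choose i) :: 'q) = 0"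
      by (intro of_nat_card_choose_eq_0) auto
    hence "(of_nat (?q choose i) :: 'q alg_closure) = 0"
      by (metis to_ac_0 to_ac_of_nat)
    thus "of_nat (?q choose i) * x ^ i * y ^ (?q - i) = 0"
      by simp
  qed auto
  also have "\<dots> = x ^ ?q + y ^ ?q"
    by simp
  finally show ?thesis .
qed

lemma alg_closure_frobenius_sum:
  fixes f :: "'b \<Rightarrow> ('q :: {field, finite}) alg_closure"
  shows "sum f A ^ CARD('q) = (\<Sum>i\<in>A. f i ^ CARD('q))"
  by (induction A rule: infinite_finite_induct) (auto simp: alg_closure_frobenius_add)

lemma alg_closure_frobenius_inject:
  fixes x y :: "('q :: {field, finite}) alg_closure"
  assumes "x ^ CARD('q) = y ^ CARD('q)"
  shows "x = y"
proof -
  have "(x - y) ^ CARD('q) = 0"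
    using alg_closure_frobenius_add[of "x - y" y] assms by simp
  thus ?thesis by simp
qed

lemma finite_power_fixed_points:
  assumes "m \<ge> 2"
  shows "finite {a :: 'a :: {comm_ring_1, ring_no_zero_divisors}. a ^ m = a}"
proof -
  \<comment> \<open>The leading coefficient is not cancelled, as \<open>m \<noteq> 1\<close>.\<close>
  define P :: "'a poly" where "P = Polynomial.monom 1 m - Polynomial.monom 1 1"
  have "poly.coeff P m = 1"
    using assms by (simp add: P_def)
  hence "P \<noteq> 0" by auto
  hence "finite {a. poly P a = 0}"
    by (rule poly_roots_finite)
  thus ?thesis
    by (simp add: P_def Polynomial.poly_monom)
qed


section \<open>The Frobenius map in affine space\<close>

text \<open>
  The Frobenius map on coordinate vectors; the exponent $q$ is the size of the base field, which is
  determined by the type.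
\<close>

definition coord_frob :: "('q :: {field, finite}) alg_closure list \<Rightarrow> 'q alg_closure list"
  where "coord_frob x = map (\<lambda>a. a ^ CARD('q)) x"

lemma length_coord_frob [simp]: "length (coord_frob x) = length x"
  by (simp add: coord_frob_def)

lemma coord_frob_inject: "coord_frob x = coord_frob y \<Longrightarrow> x = y"
  unfolding coord_frob_def by (erule map_injective) (auto intro: injI alg_closure_frobenius_inject)

lemma coord_frob_funpow:
  fixes x :: "('q :: {field, finite}) alg_closure list"
  shows "(coord_frob ^^ k) x = map (\<lambda>a. a ^ (CARD('q) ^ k)) x"
proof (induction k)
  case (Suc k)
  have "(a ^ (CARD('q) ^ k)) ^ CARD('q) = a ^ (CARD('q) ^ Suc k)" for a :: "'q alg_closure"
    by (metis power_Suc2 power_mult)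
  thus ?case
    using Suc by (simp add: coord_frob_def)
qed simp

text \<open>
  The coefficients of \<open>p\<close> lie in the base field and are therefore fixed by Frobenius.
\<close>

lemma mpoly_eval_coord_frob:
  fixes p :: "('q :: {field, finite}) mpoly"
  assumes "p \<in> mpolys (length x)"
  shows "mpoly_eval p (coord_frob x) = mpoly_eval p x ^ CARD('q)"
proof -
  have *: "coord_frob x ! i = (x ! i) ^ CARD('q)"
    if "m \<in> Poly_Mapping.keys p" "i \<in> Poly_Mapping.keys m" for m i
  proof -
    have "i < length x"
      using assms that by (auto simp: mpolys_def)
    thus ?thesis by (simp add: coord_frob_def)
  qed
  have "to_ac c ^ CARD('q) = to_ac c" for c :: 'q
    by (simp add: finite_field_power_card flip: to_ac_power)
  thus ?thesis
    unfolding mpoly_eval_def alg_closure_frobenius_sum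
    by (auto intro!: sum.cong prod.cong simp: * power_mult_distrib prod_power_distrib mult.commute
             simp flip: power_mult)
qed

lemma zclosed_length: "zclosed n Z \<Longrightarrow> x \<in> Z \<Longrightarrow> length x = n"
  by (auto simp: zclosed_def)

lemma zclosed_coord_frob_iff:
  assumes "zclosed n Z"
  shows "coord_frob x \<in> Z \<longleftrightarrow> x \<in> Z"
proof -
  obtain P where P: "P \<subseteq> mpolys n" "Z = {x. length x = n \<and> (\<forall>p\<in>P. mpoly_eval p x = 0)}"
    using assms unfolding zclosed_def by blast
  have "mpoly_eval p (coord_frob x) = 0 \<longleftrightarrow> mpoly_eval p x = 0" if "p \<in> P" "length x = n" for p
    using mpoly_eval_coord_frob[of p x] P that by auto
  thus ?thesis using P by auto
qed

lemma zopen_in_coord_frob_iff: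
  assumes "zopen_in n Y U" "\<And>x. coord_frob x \<in> Y \<longleftrightarrow> x \<in> Y"
  shows "coord_frob x \<in> U \<longleftrightarrow> x \<in> U"
  using assms zclosed_coord_frob_iff unfolding zopen_in_def by fastforce

text \<open>
  Regular functions commute with Frobenius: a fraction $g/h$ that represents \<open>f\<close> near \<open>u\<close> is also
  valid at the image of \<open>u\<close>, as open sets defined over the base field are stable under Frobenius.
\<close>

lemma regular_on_coord_frob:
  fixes u :: "('q :: {field, finite}) alg_closure list"
  assumes "regular_on n U f" "u \<in> U" "length u = n" "\<And>x. coord_frob x \<in> U \<longleftrightarrow> x \<in> U"
  shows "f (coord_frob u) = f u ^ CARD('q)"
proof -
  obtain A g h where A: "zopen_in n U A" "u \<in> A" and gh: "g \<in> mpolys n" "h \<in> mpolys n"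
    and f: "\<And>y. y \<in> A \<Longrightarrow> f y = mpoly_eval g y / mpoly_eval h y"
    using assms(1,2) unfolding regular_on_def by meson
  have "coord_frob u \<in> A"
    using zopen_in_coord_frob_iff[OF A(1) assms(4)] A(2) by blast
  thus ?thesis
    using A gh f assms(3) by (simp add: mpoly_eval_coord_frob power_divide)
qed


section \<open>The Frobenius map of a variety\<close>

context
  fixes V :: "('p, ('q :: {field, finite}) alg_closure) atlas"
  assumes V: "variety V"
begin

lemma points_variety: "points V = (\<Union>i<ncharts V. dom V i)"
  using V by (simp add: variety_def)

lemma inj_on_chart: "i < ncharts V \<Longrightarrow> inj_on (chart V i) (dom V i)"
  using V by (simp add: variety_def)

lemma zclosed_chart: "i < ncharts V \<Longrightarrow> zclosed (adim V i) (chart V i ` dom V i)"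
  using V by (simp add: variety_def)

lemma length_chart: "i < ncharts V \<Longrightarrow> x \<in> dom V i \<Longrightarrow> length (chart V i x) = adim V i"
  using zclosed_length[OF zclosed_chart] by blast

lemma overlap_coord_frob_iff:
  assumes "i < ncharts V" "j < ncharts V"
  shows "coord_frob x \<in> chart V i ` (dom V i \<inter> dom V j) \<longleftrightarrow> x \<in> chart V i ` (dom V i \<inter> dom V j)"
proof (rule zopen_in_coord_frob_iff)
  show "zopen_in (adim V i) (chart V i ` dom V i) (chart V i ` (dom V i \<inter> dom V j))"
    using V assms by (simp add: variety_def)
qed (rule zclosed_coord_frob_iff[OF zclosed_chart[OF assms(1)]])

text \<open>The Frobenius maps of two charts agree on their overlap.\<close>

lemma chart_coord_frob_compat:
  assumes i: "i < ncharts V" and j: "j < ncharts V"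
    and x: "x \<in> dom V i" "x \<in> dom V j" and y: "y \<in> dom V i"
    and eq: "chart V i y = coord_frob (chart V i x)"
  shows "y \<in> dom V j" "chart V j y = coord_frob (chart V j x)"
proof -
  let ?U = "chart V i ` (dom V i \<inter> dom V j)"
  have "chart V i y \<in> ?U"
    using overlap_coord_frob_iff[OF i j, of "chart V i x"] x eq by auto
  thus yj: "y \<in> dom V j"
    using inj_onD[OF inj_on_chart[OF i]] y by blast
  show "chart V j y = coord_frob (chart V j x)"
  proof (rule nth_equalityI)
    show "length (chart V j y) = length (coord_frob (chart V j x))"
      using length_chart[OF j] x yj by simp
  next
    fix k assume "k < length (chart V j y)"
    hence k: "k < adim V j"
      using length_chart[OF j yj] by simp
    define f where "f = (\<lambda>y. chart V j (inv_into (dom V i) (chart V i) y) ! k)"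
    have f: "f (chart V i z) = chart V j z ! k" if "z \<in> dom V i" for z
      using that inj_on_chart[OF i] by (simp add: f_def)
    have "f (coord_frob (chart V i x)) = f (chart V i x) ^ CARD('q)"
    proof (rule regular_on_coord_frob)
      show "regular_on (adim V i) ?U f"
        using V i j k unfolding f_def by (simp add: variety_def)
    qed (use x overlap_coord_frob_iff[OF i j] length_chart[OF i] in auto)
    hence "chart V j y ! k = (chart V j x ! k) ^ CARD('q)"
      using f x y by (simp flip: eq)
    thus "chart V j y ! k = coord_frob (chart V j x) ! k"
      using k length_chart[OF j x(2)] by (simp add: coord_frob_def)
  qed
qed

lemma frob_chart:
  assumes i: "i < ncharts V" and x: "x \<in> dom V i"
  shows "frob V x \<in> dom V i" "chart V i (frob V x) = coord_frob (chart V i x)"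
proof -
  have "coord_frob (chart V i x) \<in> chart V i ` dom V i"
    using zclosed_coord_frob_iff[OF zclosed_chart[OF i]] x by blast
  then obtain y where y: "y \<in> dom V i" "chart V i y = coord_frob (chart V i x)"
    by auto
  have "frob V x = y"
    unfolding frob_def coord_frob_def[symmetric]
  proof (rule the_equality)
    fix y' assume "\<exists>j<ncharts V. x \<in> dom V j \<and> y' \<in> dom V j \<and> chart V j y' = coord_frob (chart V j x)"
    then obtain j where j: "j < ncharts V" "x \<in> dom V j" "y' \<in> dom V j"
      "chart V j y' = coord_frob (chart V j x)" by blast
    have "y \<in> dom V j" "chart V j y = chart V j y'"
      using chart_coord_frob_compat[OF i j(1) x j(2) y] j(4) by auto
    thus "y' = y"
      using inj_onD[OF inj_on_chart[OF j(1)]] j(3) by metis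
  qed (use i x y in blast)
  thus "frob V x \<in> dom V i" "chart V i (frob V x) = coord_frob (chart V i x)"
    using y by auto
qed

lemma frob_funpow_chart:
  assumes "i < ncharts V" "x \<in> dom V i"
  shows "(frob V ^^ k) x \<in> dom V i \<and> chart V i ((frob V ^^ k) x) = (coord_frob ^^ k) (chart V i x)"
  by (induction k) (use assms frob_chart in auto)

lemma frob_in_points: "x \<in> points V \<Longrightarrow> frob V x \<in> points V"
  using frob_chart by (auto simp: points_variety)

text \<open>
  Frobenius is injective on coordinate vectors. Two points with the same image lie in a common chart,
  because an overlap of charts contains a point as soon as it contains the image of the point.
\<close>

lemma inj_on_frob: "inj_on (frob V) (points V)"
proof (rule inj_onI)
  fix x y assume x: "x \<in> points V" and y: "y \<in> points V" and eq: "frob V x = frob V y"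
  obtain i where i: "i < ncharts V" "x \<in> dom V i"
    using x by (auto simp: points_variety)
  obtain j where j: "j < ncharts V" "y \<in> dom V j"
    using y by (auto simp: points_variety)
  have "coord_frob (chart V j y) \<in> chart V j ` (dom V j \<inter> dom V i)"
    using frob_chart[OF i] frob_chart[OF j] eq by (metis IntI image_eqI)
  hence "chart V j y \<in> chart V j ` (dom V j \<inter> dom V i)"
    using overlap_coord_frob_iff[OF j(1) i(1)] by blast
  hence yi: "y \<in> dom V i"
    using inj_onD[OF inj_on_chart[OF j(1)]] j by blast
  have "coord_frob (chart V i x) = coord_frob (chart V i y)"
    using frob_chart[OF i] frob_chart[OF i(1) yi] eq by simp
  hence "chart V i x = chart V i y"
    by (rule coord_frob_inject)
  thus "x = y"
    using inj_onD[OF inj_on_chart[OF i(1)]] i yi by blast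
qed

text \<open>
  In each chart, the coordinates of such a point are among the finitely many roots of $X^{q^k} - X$.
\<close>

lemma finite_frob_funpow_fixed_points:
  assumes "k > 0"
  shows "finite {x \<in> points V. (frob V ^^ k) x = x}"
proof -
  define R where "R = {a :: 'q alg_closure. a ^ (CARD('q) ^ k) = a}"
  have "CARD('q) ^ 1 \<le> CARD('q) ^ k"
    using assms by (intro power_increasing) auto
  hence "finite R"
    unfolding R_def using card_field_ge_2[where 'q = 'q] by (intro finite_power_fixed_points) simp
  have "finite {x \<in> dom V i. (frob V ^^ k) x = x}" if i: "i < ncharts V" for i
  proof (rule inj_on_finite)
    show "inj_on (chart V i) {x \<in> dom V i. (frob V ^^ k) x = x}"
      by (rule inj_on_subset[OF inj_on_chart[OF i]]) auto
    show "chart V i ` {x \<in> dom V i. (frob V ^^ k) x = x}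
            \<subseteq> {xs. set xs \<subseteq> R \<and> length xs = adim V i}"
    proof safe
      fix x a assume x: "x \<in> dom V i" "(frob V ^^ k) x = x" and a: "a \<in> set (chart V i x)"
      have "map (\<lambda>a. a ^ (CARD('q) ^ k)) (chart V i x) = map (\<lambda>a. a) (chart V i x)"
        using frob_funpow_chart[OF i x(1), of k] x(2) by (simp add: coord_frob_funpow)
      thus "a \<in> R"
        using a unfolding R_def map_eq_conv by simp
    qed (rule length_chart[OF i])
    show "finite {xs. set xs \<subseteq> R \<and> length xs = adim V i}"
      by (rule finite_lists_length_eq) fact
  qed
  moreover have "{x \<in> points V. (frob V ^^ k) x = x}
                   = (\<Union>i<ncharts V. {x \<in> dom V i. (frob V ^^ k) x = x})"
    by (auto simp: points_variety)
  ultimately show ?thesis by simp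
qed

end


section \<open>Finite orbits of an injective self-map\<close>

text \<open>
  Only nonnegative iterates are used. A finite forward orbit of an injective map is a cycle, and
  then it is a full orbit; an infinite one need not contain all preimages of its elements.
\<close>

definition forward_orbit :: "('a \<Rightarrow> 'a) \<Rightarrow> 'a \<Rightarrow> 'a set"
  where "forward_orbit f x = range (\<lambda>k. (f ^^ k) x)"

lemma forward_orbit_self: "x \<in> forward_orbit f x"
  unfolding forward_orbit_def by (rule range_eqI[of _ _ 0]) simp

lemma forward_orbit_funpow_image: "forward_orbit f ((f ^^ k) x) = (f ^^ k) ` forward_orbit f x"
proof -
  have "(f ^^ j) ((f ^^ k) x) = (f ^^ k) ((f ^^ j) x)" for j
    by (metis add.commute comp_apply funpow_add)
  thus ?thesis
    by (simp add: forward_orbit_def image_image)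
qed

lemma forward_orbit_image: "forward_orbit f (f x) = f ` forward_orbit f x"
  using forward_orbit_funpow_image[of f 1 x] by simp

lemma forward_orbit_insert: "forward_orbit f x = insert x (forward_orbit f (f x))"
proof -
  have "(UNIV :: nat set) = insert 0 (range Suc)"
    by (auto simp: image_iff) (metis not0_implies_Suc)
  hence "forward_orbit f x = (\<lambda>k. (f ^^ k) x) ` insert 0 (range Suc)"
    by (simp add: forward_orbit_def)
  thus ?thesis
    by (simp add: forward_orbit_def image_image funpow_swap1)
qed

lemma finite_forward_orbit_step: "finite (forward_orbit f (f x)) \<longleftrightarrow> finite (forward_orbit f x)"
  by (metis finite_insert forward_orbit_insert)

context
  fixes f :: "'a \<Rightarrow> 'a" and P :: "'a set"
  assumes maps: "\<And>x. x \<in> P \<Longrightarrow> f x \<in> P"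
begin

lemma funpow_maps: "x \<in> P \<Longrightarrow> (f ^^ k) x \<in> P"
  by (induction k) (auto simp: maps)

lemma forward_orbit_subset: "x \<in> P \<Longrightarrow> forward_orbit f x \<subseteq> P"
  using funpow_maps by (auto simp: forward_orbit_def)

context
  assumes inj: "inj_on f P"
begin

lemma forward_orbit_step:
  assumes "x \<in> P" "finite (forward_orbit f x)"
  shows "forward_orbit f (f x) = forward_orbit f x"
  unfolding forward_orbit_image
proof (rule endo_inj_surj)
  show "f ` forward_orbit f x \<subseteq> forward_orbit f x"
    by (metis forward_orbit_image forward_orbit_insert subset_insertI)
qed (use assms inj forward_orbit_subset inj_on_subset in blast)+

lemma forward_orbit_eq:
  assumes "x \<in> P" "finite (forward_orbit f x)" "y \<in> forward_orbit f x"
  shows "forward_orbit f y = forward_orbit f x"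
proof -
  have "forward_orbit f ((f ^^ k) x) = forward_orbit f x" for k
    by (induction k) (use assms funpow_maps forward_orbit_step in auto)
  thus ?thesis
    using assms(3) by (auto simp: forward_orbit_def)
qed

lemma funpow_cancel:
  assumes "x \<in> P" "(f ^^ i) x = (f ^^ (i + k)) x"
  shows "(f ^^ k) x = x"
  using assms(2)
proof (induction i)
  case (Suc i)
  thus ?case
    using inj_onD[OF inj, of "(f ^^ i) x" "(f ^^ (i + k)) x"] funpow_maps[OF assms(1)] by simp
qed simp

lemma forward_orbit_period:
  assumes "x \<in> P" "finite (forward_orbit f x)"
  obtains k where "0 < k" "k \<le> card (forward_orbit f x)" "(f ^^ k) x = x"
proof -
  let ?d = "card (forward_orbit f x)"
  \<comment> \<open>There are \<open>?d + 1\<close> iterates with exponent at most \<open>?d\<close>, so two of them coincide.\<close>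
  have "\<not> inj_on (\<lambda>k. (f ^^ k) x) {..?d}"
  proof
    assume "inj_on (\<lambda>k. (f ^^ k) x) {..?d}"
    hence "card {..?d} \<le> ?d"
      by (rule card_inj_on_le) (use assms in \<open>auto simp: forward_orbit_def\<close>)
    thus False by simp
  qed
  then obtain i j where "i < j" "j \<le> ?d" "(f ^^ i) x = (f ^^ j) x"
    unfolding inj_on_def by (metis atMost_iff linorder_neqE_nat)
  thus ?thesis
    using that[of "j - i"] funpow_cancel[OF assms(1), of i "j - i"] by simp
qed

end

end


section \<open>Frobenius orbits of a variety\<close>

lemma frob_orbits_eq: "frob_orbits V = forward_orbit (frob V) ` points V"
  by (simp add: frob_orbits_def forward_orbit_def)

context
  fixes V :: "('p, ('q :: {field, finite}) alg_closure) atlas"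
  assumes V: "variety V"
begin

lemma frob_orbit_subset: "B \<in> frob_orbits V \<Longrightarrow> B \<subseteq> points V"
  using forward_orbit_subset[where f = "frob V", OF frob_in_points[OF V]] by (auto simp: frob_orbits_eq)

lemma frob_orbit_nonempty: "B \<in> frob_orbits V \<Longrightarrow> B \<noteq> {}"
  using forward_orbit_self by (fastforce simp: frob_orbits_eq)

lemma forward_orbit_in_frob_orbit:
  assumes "B \<in> frob_orbits V" "finite B" "x \<in> B"
  shows "forward_orbit (frob V) x = B"
  using forward_orbit_eq[OF frob_in_points[OF V] inj_on_frob[OF V]] assms
  by (auto simp: frob_orbits_eq)

lemma finite_frob_orbits_of_bounded_card:
  "finite {B \<in> frob_orbits V. 0 < card B \<and> card B \<le> n}"
proof (rule finite_subset)
  let ?F = "\<Union>k\<in>{0<..n}. {x \<in> points V. (frob V ^^ k) x = x}"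
  show "{B \<in> frob_orbits V. 0 < card B \<and> card B \<le> n} \<subseteq> forward_orbit (frob V) ` ?F"
  proof safe
    fix B assume B: "B \<in> frob_orbits V" "0 < card B" "card B \<le> n"
    then obtain x where x: "x \<in> points V" "B = forward_orbit (frob V) x"
      by (auto simp: frob_orbits_eq)
    moreover have "finite B"
      using B by (simp add: card_gt_0_iff)
    ultimately obtain k where "0 < k" "k \<le> card B" "(frob V ^^ k) x = x"
      using forward_orbit_period[OF frob_in_points[OF V] inj_on_frob[OF V]] by metis
    hence "x \<in> ?F"
      using x(1) B(3) by force
    thus "B \<in> forward_orbit (frob V) ` ?F"
      using x(2) by blast
  qed
  show "finite (forward_orbit (frob V) ` ?F)"
    using finite_frob_funpow_fixed_points[OF V] by auto
qed

end


section \<open>Products of generating functions\<close>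

lemma finite_weighted_families:
  fixes d :: "'b \<Rightarrow> 'c \<Rightarrow> nat"
  assumes "finite A" "\<And>B m. B \<in> A \<Longrightarrow> finite {c. d B c = m}"
  shows "finite {F \<in> A \<rightarrow>\<^sub>E UNIV. (\<Sum>B\<in>A. d B (F B)) = n}"
proof (rule finite_subset)
  show "{F \<in> A \<rightarrow>\<^sub>E UNIV. (\<Sum>B\<in>A. d B (F B)) = n} \<subseteq> (\<Pi>\<^sub>E B\<in>A. \<Union>m\<le>n. {c. d B c = m})"
    using member_le_sum[of _ A "\<lambda>B. d B (_ B)"] assms(1) by (auto intro!: PiE_I)
qed (use assms in \<open>auto intro!: finite_PiE\<close>)

text \<open>
  The product of generating functions counts families of colors with the sum of the degrees as degree
  and the product of the weights as weight. Families indexed by \<open>A\<close> are extensional, i.e.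
  \<^const>\<open>undefined\<close> outside of \<open>A\<close>, so that each is counted once.
\<close>

lemma prod_generating_functions:
  fixes d :: "'b \<Rightarrow> 'c \<Rightarrow> nat" and w :: "'b \<Rightarrow> 'c \<Rightarrow> 'r :: comm_semiring_1"
  assumes "finite A" "\<And>B m. B \<in> A \<Longrightarrow> finite {c. d B c = m}"
  shows "(\<Prod>B\<in>A. Abs_fps (\<lambda>n. \<Sum>c | d B c = n. w B c)) =
         Abs_fps (\<lambda>n. \<Sum>F | F \<in> A \<rightarrow>\<^sub>E UNIV \<and> (\<Sum>B\<in>A. d B (F B)) = n. \<Prod>B\<in>A. w B (F B))"
  using assms
proof (induction A rule: finite_induct)
  case empty
  have "{F. F = (\<lambda>_. undefined) \<and> n = 0} = (if n = 0 then {\<lambda>_. undefined} else {})" for n :: nat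
    by auto
  thus ?case
    by (auto simp: fps_eq_iff)
next
  case (insert a A)
  let ?S = "\<lambda>A n. {F. F \<in> A \<rightarrow>\<^sub>E UNIV \<and> (\<Sum>B\<in>A. d B (F B)) = n}"
  have fin: "finite (?S A n)" for n
    using insert finite_weighted_families[of A d n] by simp
  have "fps_nth (\<Prod>B\<in>insert a A. Abs_fps (\<lambda>n. \<Sum>c | d B c = n. w B c)) n
          = (\<Sum>F\<in>?S (insert a A) n. \<Prod>B\<in>insert a A. w B (F B))" for n
  proof -
    have "fps_nth (\<Prod>B\<in>insert a A. Abs_fps (\<lambda>n. \<Sum>c | d B c = n. w B c)) n
            = (\<Sum>i\<le>n. (\<Sum>c | d a c = i. w a c) * (\<Sum>F\<in>?S A (n - i). \<Prod>B\<in>A. w B (F B)))"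
      using insert by (simp add: fps_mult_nth atMost_atLeast0)
    also have "\<dots> = (\<Sum>i\<le>n. \<Sum>(c, F)\<in>{c. d a c = i} \<times> ?S A (n - i). w a c * (\<Prod>B\<in>A. w B (F B)))"
      by (simp add: sum_product sum.cartesian_product)
    also have "\<dots> = (\<Sum>(i, c, F)\<in>(SIGMA i:{..n}. {c. d a c = i} \<times> ?S A (n - i)).
                       w a c * (\<Prod>B\<in>A. w B (F B)))"
      using insert fin by (subst sum.Sigma) (auto simp: case_prod_unfold)
    also have "\<dots> = (\<Sum>F\<in>?S (insert a A) n. \<Prod>B\<in>insert a A. w B (F B))"
    proof (rule sum.reindex_bij_witness[of _ "\<lambda>F. (d a (F a), F a, F(a := undefined))"
                                             "\<lambda>(i, c, F). F(a := c)"], goal_cases)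
      case (1 s)
      thus ?case using insert(2) by (auto simp: PiE_def extensional_def)
    next
      case (2 s)
      have "(\<Sum>B\<in>A. d B (((snd (snd s))(a := fst (snd s))) B)) = (\<Sum>B\<in>A. d B (snd (snd s) B))"
        by (rule sum.cong) (use insert(2) in auto)
      thus ?case using 2 insert(1,2) by (auto simp: PiE_def extensional_def case_prod_unfold)
    next
      case (3 F)
      thus ?case by auto
    next
      case (4 F)
      have "(\<Sum>B\<in>A. d B ((F(a := undefined)) B)) = (\<Sum>B\<in>A. d B (F B))"
        by (rule sum.cong) (use insert(2) in auto)
      thus ?case using 4 insert(1,2) by (auto simp: PiE_def extensional_def)
    next
      case (5 s)
      have "(\<Prod>B\<in>A. w B (((snd (snd s))(a := fst (snd s))) B)) = (\<Prod>B\<in>A. w B (snd (snd s) B))"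
        by (rule prod.cong) (use insert(2) in auto)
      thus ?case using insert(1,2) by (auto simp: case_prod_unfold)
    qed
    finally show ?thesis .
  qed
  thus ?case by (simp add: fps_eq_iff)
qed


section \<open>Substitution in generating functions\<close>

lemma msubst_0 [simp]: "msubst d 0 = 0"
  by transfer auto

lemma msubst_add: "msubst d (f + g) = msubst d f + msubst d g"
  by transfer auto

lemma msubst_sum: "msubst d (sum f A) = (\<Sum>x\<in>A. msubst d (f x))"
  by (induction A rule: infinite_finite_induct) (auto simp: msubst_add)

lemma msubst_1:
  assumes "d > 0"
  shows "msubst d 1 = 1"
proof (rule mlaurent_eqI)
  fix e :: "int ^ 'n"
  have "(\<chi> i. e $ i div int d) = 0 \<longleftrightarrow> e = 0" if "\<forall>i. int d dvd e $ i"
    using that assms by (auto simp: vec_eq_iff dvd_div_eq_0_iff)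
  thus "mcoeff (msubst d 1) e = mcoeff 1 e"
    by (auto simp: msubst.rep_eq one_mlaurent.rep_eq)
qed

lemma subst_tT_generating_function:
  assumes d: "d > 0" and fin: "\<And>n. finite {c. g c = n}"
  shows "subst_tT d (Abs_fps (\<lambda>n. \<Sum>c | g c = n. w c)) =
         Abs_fps (\<lambda>n. \<Sum>c | d * g c = n. msubst d (w c))"
proof (rule fps_ext)
  fix n
  have *: "i \<le> n" if "n = d * i" for i
    using that d by simp
  have "fps_nth (subst_tT d (Abs_fps (\<lambda>n. \<Sum>c | g c = n. w c))) n
          = (\<Sum>i = 0..n. if n = d * i then \<Sum>c | g c = i. msubst d (w c) else 0)"
    by (simp add: subst_tT_def fps_compose_nth msubst_sum flip: power_mult)
       (rule sum.cong, auto)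
  also have "\<dots> = (\<Sum>i | i \<in> {0..n} \<and> n = d * i. \<Sum>c | g c = i. msubst d (w c))"
    by (rule sum.inter_filter[symmetric]) simp
  also have "\<dots> = (\<Sum>c | d * g c = n. msubst d (w c))"
  proof (cases "d dvd n")
    case True
    then obtain m where m: "n = d * m" by blast
    have "{i. i \<in> {0..n} \<and> n = d * i} = {m}"
      using * m d by auto
    thus ?thesis using m d by simp
  next
    case False
    hence empty: "{i. i \<in> {0..n} \<and> n = d * i} = {}" "{c. d * g c = n} = {}"
      by auto
    show ?thesis unfolding empty by simp
  qed
  finally show "fps_nth (subst_tT d (Abs_fps (\<lambda>n. \<Sum>c | g c = n. w c))) n
    = fps_nth (Abs_fps (\<lambda>n. \<Sum>c | d * g c = n. msubst d (w c))) n"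
    by simp
qed


section \<open>Colorings as families indexed by orbits\<close>

context
  fixes V :: "('p, ('q :: {field, finite}) alg_closure) atlas"
    and C :: "('c, ('n :: finite) mlaurent) coloring_data"
  assumes V: "variety V" and C: "coloring_data C"
begin

lemma cdeg_eq_0_iff: "cdeg C c = 0 \<longleftrightarrow> c = zero_color C"
proof -
  have ex1: "\<exists>!c. cdeg C c = 0" using C by (simp add: coloring_data_def)
  thus ?thesis using theI'[OF ex1] unfolding zero_color_def by blast
qed

lemma coloring_const_on_orbit:
  assumes "L \<in> colorings C V" "x \<in> points V" "y \<in> forward_orbit (frob V) x"
  shows "L y = L x"
proof -
  have "(frob V ^^ k) x \<in> points V" for k
    by (rule funpow_maps[OF frob_in_points[OF V] assms(2)])
  hence "L ((frob V ^^ k) x) = L x" for k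
    by (induction k) (use assms(1) in \<open>simp_all add: colorings_def\<close>)
  thus ?thesis using assms(3) by (auto simp: forward_orbit_def)
qed

lemma the_elem_coloring_image:
  assumes "L \<in> colorings C V" "B \<in> frob_orbits V" "x \<in> B"
  shows "the_elem (L ` B) = L x"
proof -
  have "L ` B = {L x}"
    using assms coloring_const_on_orbit by (force simp: frob_orbits_eq)
  thus ?thesis by simp
qed

text \<open>
  The orbits on which \<open>L\<close> does not take the zero color. If \<open>L\<close> is invariant under Frobenius and has
  finite support, these orbits are finite, there are finitely many of them, and they partition the
  support.
\<close>

definition support_orbits :: "('p \<Rightarrow> 'c) \<Rightarrow> 'p set set"
  where "support_orbits L = {B \<in> frob_orbits V. B \<subseteq> colored_points C V L}"

lemma finite_support_orbits:
  assumes "L \<in> colorings C V"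
  shows "finite (support_orbits L)" "B \<in> support_orbits L \<Longrightarrow> finite B"
proof -
  have fin: "finite (colored_points C V L)"
    using assms by (simp add: colorings_def)
  show "finite (support_orbits L)"
    by (rule finite_subset[of _ "Pow (colored_points C V L)"])
       (use fin in \<open>auto simp: support_orbits_def\<close>)
  show "finite B" if "B \<in> support_orbits L"
    using that fin finite_subset by (auto simp: support_orbits_def)
qed

lemma forward_orbit_in_support:
  assumes "L \<in> colorings C V" "x \<in> points V" "L x \<noteq> zero_color C"
  shows "forward_orbit (frob V) x \<in> support_orbits L"
  using assms coloring_const_on_orbit[OF assms(1,2)]
    forward_orbit_subset[where f = "frob V", OF frob_in_points[OF V] assms(2)]
  by (auto simp: support_orbits_def frob_orbits_eq colored_points_def)

lemma coloring_deg_eq_sum_orbits: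
  assumes L: "L \<in> colorings C V"
  shows "coloring_deg C V L = (\<Sum>B\<in>support_orbits L. card B * cdeg C (the_elem (L ` B)))"
proof -
  have "colored_points C V L = \<Union>(support_orbits L)"
    using forward_orbit_in_support[OF L] forward_orbit_self[of _ "frob V"]
    by (fastforce simp: colored_points_def support_orbits_def)
  moreover have "B \<inter> B' = {}" if B: "B \<in> support_orbits L" "B' \<in> support_orbits L" "B \<noteq> B'" for B B'
  proof -
    have "forward_orbit (frob V) x = A" if "A \<in> support_orbits L" "x \<in> A" for A x
      using that forward_orbit_in_frob_orbit[OF V] finite_support_orbits(2)[OF L]
      by (simp add: support_orbits_def)
    thus ?thesis using B by blast
  qed
  ultimately have "coloring_deg C V L = (\<Sum>B\<in>support_orbits L. \<Sum>x\<in>B. cdeg C (L x))"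
    using finite_support_orbits[OF L] by (simp add: coloring_deg_def sum.Union_disjoint)
  also have "\<dots> = (\<Sum>B\<in>support_orbits L. \<Sum>x\<in>B. cdeg C (the_elem (L ` B)))"
    by (intro sum.cong refl)
       (use the_elem_coloring_image[OF L] in \<open>auto simp: support_orbits_def\<close>)
  finally show ?thesis by simp
qed

text \<open>
  Only the zero color has degree 0, so each point of the support contributes at least 1 to the degree.
\<close>

lemma support_orbit_card_le_deg:
  assumes L: "L \<in> colorings C V" and B: "B \<in> support_orbits L"
  shows "0 < card B" "card B \<le> coloring_deg C V L"
proof -
  have "B \<noteq> {}"
    using B frob_orbit_nonempty[OF V] by (auto simp: support_orbits_def)
  then obtain x where x: "x \<in> B" by blast
  show "0 < card B"
    using x finite_support_orbits(2)[OF L B] by (auto simp: card_gt_0_iff)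
  have "L x \<noteq> zero_color C"
    using x B by (auto simp: support_orbits_def colored_points_def)
  moreover have "the_elem (L ` B) = L x"
    using the_elem_coloring_image[OF L _ x] B by (simp add: support_orbits_def)
  ultimately have "cdeg C (the_elem (L ` B)) > 0"
    using cdeg_eq_0_iff by auto
  hence "card B \<le> card B * cdeg C (the_elem (L ` B))"
    by simp
  also have "\<dots> \<le> coloring_deg C V L"
    unfolding coloring_deg_eq_sum_orbits[OF L]
    by (rule member_le_sum[OF B]) (use finite_support_orbits[OF L] in auto)
  finally show "card B \<le> coloring_deg C V L" .
qed

text \<open>
  Orbits outside of the support carry the color of degree 0 and weight 1, so degree and weight may
  be computed over any larger finite set of finite orbits.
\<close>

lemma coloring_deg_weight_eq:
  assumes L: "L \<in> colorings C V" and S: "S \<subseteq> frob_orbits V" "finite S" "\<forall>B\<in>S. finite B"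
    and sub: "support_orbits L \<subseteq> S"
  shows "coloring_deg C V L = (\<Sum>B\<in>S. card B * cdeg C (the_elem (L ` B)))"
    and "coloring_weight C V L = (\<Prod>B\<in>S. msubst (card B) (cweight C (the_elem (L ` B))))"
proof -
  have zero: "the_elem (L ` B) = zero_color C" and pos: "card B > 0"
    if "B \<in> S - support_orbits L" for B
  proof -
    have B: "B \<in> frob_orbits V" "finite B"
      using that S by auto
    hence B': "B \<noteq> {}" "B \<subseteq> points V"
      using frob_orbit_nonempty[OF V] frob_orbit_subset[OF V] by blast+
    show "card B > 0" using B B' by (simp add: card_gt_0_iff)
    obtain x where x: "x \<in> B" using B' by blast
    have "x \<in> points V" using x B' by blast
    hence "L x = zero_color C"
      using forward_orbit_in_support[OF L, of x] forward_orbit_in_frob_orbit[OF V B x] that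
      by auto
    thus "the_elem (L ` B) = zero_color C"
      using the_elem_coloring_image[OF L B(1) x] by simp
  qed
  show "coloring_deg C V L = (\<Sum>B\<in>S. card B * cdeg C (the_elem (L ` B)))"
    unfolding coloring_deg_eq_sum_orbits[OF L]
    by (rule sum.mono_neutral_left) (use S sub zero cdeg_eq_0_iff in auto)
  have "cweight C (zero_color C) = 1"
    using C by (simp add: coloring_data_def)
  thus "coloring_weight C V L = (\<Prod>B\<in>S. msubst (card B) (cweight C (the_elem (L ` B))))"
    unfolding coloring_weight_def support_orbits_def[symmetric]
    by (intro prod.mono_neutral_left) (use S sub zero pos in \<open>auto simp: msubst_1\<close>)
qed

text \<open>The coloring that takes the value \<open>F B\<close> on each orbit \<open>B\<close> in \<open>S\<close> and is zero elsewhere.\<close>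

definition extend_coloring :: "'p set set \<Rightarrow> ('p set \<Rightarrow> 'c) \<Rightarrow> 'p \<Rightarrow> 'c"
  where "extend_coloring S F = (\<lambda>x\<in>points V.
           if forward_orbit (frob V) x \<in> S then F (forward_orbit (frob V) x) else zero_color C)"

context
  fixes S :: "'p set set"
  assumes S: "S \<subseteq> frob_orbits V" "finite S" "\<forall>B\<in>S. finite B"
begin

lemma extend_coloring_in_colorings: "extend_coloring S F \<in> colorings C V"
proof -
  have "colored_points C V (extend_coloring S F) \<subseteq> \<Union>S"
    using forward_orbit_self[of _ "frob V"]
    by (auto simp: colored_points_def extend_coloring_def split: if_splits)
  moreover have "finite (\<Union>S)"
    using S by blast
  moreover have "extend_coloring S F (frob V x) = extend_coloring S F x" if x: "x \<in> points V" for x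
  proof (cases "finite (forward_orbit (frob V) x)")
    case True
    thus ?thesis
      using forward_orbit_step[OF frob_in_points[OF V] inj_on_frob[OF V] x] frob_in_points[OF V x] x
      by (simp add: extend_coloring_def)
  next
    case False
    hence "infinite (forward_orbit (frob V) (frob V x))"
      by (simp add: finite_forward_orbit_step)
    hence "forward_orbit (frob V) x \<notin> S" "forward_orbit (frob V) (frob V x) \<notin> S"
      using False S(3) by auto
    thus ?thesis
      using frob_in_points[OF V x] x by (simp add: extend_coloring_def)
  qed
  ultimately show ?thesis
    using finite_subset by (auto simp: colorings_def extend_coloring_def)
qed

lemma extend_coloring_eq: "B \<in> S \<Longrightarrow> x \<in> B \<Longrightarrow> extend_coloring S F x = F B"
  using forward_orbit_in_frob_orbit[OF V, of B x] S frob_orbit_subset[OF V, of B]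
  by (auto simp: extend_coloring_def)

lemma the_elem_extend_coloring: "B \<in> S \<Longrightarrow> the_elem (extend_coloring S F ` B) = F B"
  using the_elem_coloring_image[OF extend_coloring_in_colorings] extend_coloring_eq
    frob_orbit_nonempty[OF V] S(1) by (metis all_not_in_conv subsetD)

lemma support_extend_coloring: "support_orbits (extend_coloring S F) \<subseteq> S"
proof
  fix B assume B: "B \<in> support_orbits (extend_coloring S F)"
  hence "B \<in> frob_orbits V" "finite B"
    using finite_support_orbits[OF extend_coloring_in_colorings] by (auto simp: support_orbits_def)
  moreover from this obtain x where x: "x \<in> B"
    using frob_orbit_nonempty[OF V] by blast
  ultimately have "forward_orbit (frob V) x = B"
    using forward_orbit_in_frob_orbit[OF V] by blast
  thus "B \<in> S"
    using x B by (auto simp: support_orbits_def colored_points_def extend_coloring_def split: if_splits)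
qed

lemma extend_coloring_restrict:
  assumes L: "L \<in> colorings C V" and sub: "support_orbits L \<subseteq> S"
  shows "extend_coloring S (\<lambda>B\<in>S. the_elem (L ` B)) = L"
proof
  fix x
  show "extend_coloring S (\<lambda>B\<in>S. the_elem (L ` B)) x = L x"
  proof (cases "x \<in> points V")
    case True
    have "forward_orbit (frob V) x \<in> frob_orbits V"
      using True by (simp add: frob_orbits_eq)
    hence "the_elem (L ` forward_orbit (frob V) x) = L x"
      using the_elem_coloring_image[OF L] forward_orbit_self by metis
    moreover have "L x = zero_color C \<or> forward_orbit (frob V) x \<in> S"
      using forward_orbit_in_support[OF L True] sub by blast
    ultimately show ?thesis
      using True by (auto simp: extend_coloring_def)
  next
    case False
    thus ?thesis using L by (auto simp: extend_coloring_def colorings_def)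
  qed
qed

text \<open>
  The set \<open>S\<close> of orbits sees all colorings of degree \<open>n\<close> as soon as it contains all orbits with at
  most \<open>n\<close> elements.
\<close>

lemma coloring_zeta_nth_eq:
  assumes n: "\<And>B. B \<in> frob_orbits V \<Longrightarrow> 0 < card B \<Longrightarrow> card B \<le> n \<Longrightarrow> B \<in> S"
  shows "fps_nth (coloring_zeta C V) n =
         (\<Sum>F | F \<in> S \<rightarrow>\<^sub>E UNIV \<and> (\<Sum>B\<in>S. card B * cdeg C (F B)) = n.
            \<Prod>B\<in>S. msubst (card B) (cweight C (F B)))"
proof -
  have sub: "support_orbits L \<subseteq> S" if "L \<in> colorings C V" "coloring_deg C V L = n" for L
    using support_orbit_card_le_deg[OF that(1)] that(2) n by (auto simp: support_orbits_def)
  note eq = coloring_deg_weight_eq[OF _ S]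
  note ext = eq[OF extend_coloring_in_colorings support_extend_coloring]
  have "(\<Sum>L | L \<in> colorings C V \<and> coloring_deg C V L = n. coloring_weight C V L) =
        (\<Sum>F | F \<in> S \<rightarrow>\<^sub>E UNIV \<and> (\<Sum>B\<in>S. card B * cdeg C (F B)) = n.
            \<Prod>B\<in>S. msubst (card B) (cweight C (F B)))"
  proof (rule sum.reindex_bij_witness[of _ "extend_coloring S" "\<lambda>L. \<lambda>B\<in>S. the_elem (L ` B)"], goal_cases)
    case (1 L)
    thus ?case using sub extend_coloring_restrict by simp
  next
    case (2 L)
    thus ?case using sub[of L] eq(1)[of L] by simp
  next
    case (3 F)
    thus ?case
      by (auto simp: the_elem_extend_coloring PiE_def extensional_def)
  next
    case (4 F)
    thus ?case using ext(1) by (simp add: extend_coloring_in_colorings the_elem_extend_coloring)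
  next
    case (5 L)
    thus ?case using sub[of L] eq(2)[of L] by simp
  qed
  thus ?thesis by (simp add: coloring_zeta_def)
qed

end

lemma coloring_zeta_nth_0: "fps_nth (coloring_zeta C V) 0 = 1"
proof -
  have "{F :: 'p set \<Rightarrow> 'c. F \<in> {} \<rightarrow>\<^sub>E UNIV \<and> (\<Sum>B\<in>{}. card B * cdeg C (F B)) = 0} = {\<lambda>_. undefined}"
    by auto
  thus ?thesis
    by (subst coloring_zeta_nth_eq[of "{}"]) auto
qed

text \<open>
  The partial product over \<open>d \<le> D\<close> has one factor for each orbit with at most \<open>D + 1\<close> elements.
\<close>

lemma prod_subst_tT_nth:
  assumes "n \<le> Suc D"
  shows "fps_nth (\<Prod>d\<le>D. subst_tT (Suc d)
           (coloring_zeta C (point_variety :: (unit, 'q alg_closure) atlas)) ^ num_orbits V (Suc d)) n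
         = fps_nth (coloring_zeta C V) n"
proof -
  let ?Z = "coloring_zeta C (point_variety :: (unit, 'q alg_closure) atlas)"
  define S where "S = {B \<in> frob_orbits V. 0 < card B \<and> card B \<le> Suc D}"
  have S: "S \<subseteq> frob_orbits V" "finite S" "\<forall>B\<in>S. finite B"
    using finite_frob_orbits_of_bounded_card[OF V, of "Suc D"] by (auto simp: S_def card_gt_0_iff)
  have fin: "finite {c. cdeg C c = m}" for m
    using C by (simp add: coloring_data_def)
  have fib: "finite {c. card B * cdeg C c = m}" if "B \<in> S" for B m
  proof (rule finite_subset)
    show "{c. card B * cdeg C c = m} \<subseteq> {c. cdeg C c = m div card B}"
      using that by (auto simp: S_def)
  qed (rule fin)
  \<comment> \<open>Index \<open>d\<close> belongs to the orbits of size \<open>d + 1\<close>, and \<open>card B > 0\<close> excludes the infinite orbits.\<close>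
  have "(\<Prod>d\<le>D. subst_tT (Suc d) ?Z ^ num_orbits V (Suc d))
          = (\<Prod>d\<le>D. \<Prod>B | B \<in> S \<and> card B - 1 = d. subst_tT (card B) ?Z)"
  proof (rule prod.cong[OF refl])
    fix d assume "d \<in> {..D}"
    hence eq: "{B. B \<in> S \<and> card B - 1 = d} = {B \<in> frob_orbits V. card B = Suc d}"
      by (auto simp: S_def)
    show "subst_tT (Suc d) ?Z ^ num_orbits V (Suc d)
            = (\<Prod>B | B \<in> S \<and> card B - 1 = d. subst_tT (card B) ?Z)"
      unfolding eq num_orbits_def by simp
  qed
  also have "\<dots> = (\<Prod>B\<in>S. subst_tT (card B) ?Z)"
  proof (rule prod.group)
    show "(\<lambda>B. card B - 1) ` S \<subseteq> {..D}"
      by (auto simp: S_def)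
  qed (use S(2) in simp_all)
  also have "\<dots> = (\<Prod>B\<in>S. Abs_fps (\<lambda>n. \<Sum>c | card B * cdeg C c = n. msubst (card B) (cweight C c)))"
    unfolding coloring_zeta_point[OF C]
    by (intro prod.cong refl subst_tT_generating_function fin) (simp add: S_def)
  also have "\<dots> = Abs_fps (\<lambda>n. \<Sum>F | F \<in> S \<rightarrow>\<^sub>E UNIV \<and> (\<Sum>B\<in>S. card B * cdeg C (F B)) = n.
                      \<Prod>B\<in>S. msubst (card B) (cweight C (F B)))"
    by (rule prod_generating_functions[OF S(2) fib])
  also have "fps_nth \<dots> n = fps_nth (coloring_zeta C V) n"
  proof -
    have "B \<in> S" if "B \<in> frob_orbits V" "0 < card B" "card B \<le> n" for B
      using that assms by (simp add: S_def)
    from coloring_zeta_nth_eq[OF S this] show ?thesis by simp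
  qed
  finally show ?thesis .
qed

end

theorem theorem1:
  fixes V :: "('p, ('q :: {field, finite}) alg_closure) atlas"
    and C :: "('c, ('n :: finite) mlaurent) coloring_data"
  assumes "variety V" and "coloring_data C"
  shows "(\<lambda>d. subst_tT (Suc d)
              (coloring_zeta C (point_variety :: (unit, 'q alg_closure) atlas))
            ^ num_orbits V (Suc d))
         has_prod coloring_zeta C V"
proof -
  have "coloring_zeta C V \<noteq> 0"
    using coloring_zeta_nth_0[OF assms] by auto
  moreover have "(\<lambda>D. \<Prod>d\<le>D. subst_tT (Suc d)
              (coloring_zeta C (point_variety :: (unit, 'q alg_closure) atlas))
            ^ num_orbits V (Suc d)) \<longlonglongrightarrow> coloring_zeta C V"
  proof (rule tendsto_fpsI)
    fix n
    show "\<forall>\<^sub>F D in sequentially.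
            fps_nth (\<Prod>d\<le>D. subst_tT (Suc d)
              (coloring_zeta C (point_variety :: (unit, 'q alg_closure) atlas))
                ^ num_orbits V (Suc d)) n = fps_nth (coloring_zeta C V) n"
      using eventually_ge_at_top[of n]
      by eventually_elim (rule prod_subst_tT_nth[OF assms], simp)
  qed
  ultimately show ?thesis
    by (simp add: has_prod_def raw_has_prod_def)
qed

end
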